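(* Let $a,b,k,n,s,\ell$ be real numbers with $a>0$, $b>0$, $s>-1$ and $\ell>-1$ (and $k,n\in\mathbb{R}$ arbitrary). Then \[ \int_0^1 \frac{x^{\ell} (1-x)^{s}}{(x+a)^{k+1} \, (x+b)^{n+1}} \, \mathrm{d}x = \frac{(b+1)^{s-n}}{b^{n-\ell}} \int_0^1 \frac{x^{s} \, (1-x)^{\ell} \, (x+b)^{n+k-\ell-s}}{\bigl((a-b)\, x + (a+1)b \bigr)^{k+1}} \, \mathrm{d}x. \]
   Context: All powers are real powers of positive real numbers (on $0<x<1$ the quantities $x$, $1-x$, $x+a$, $x+b$ and $(a-b)x+(a+1)b$ are positive). *)

theory Defs
  imports "HOL-Analysis.Analysis"
begin

end

(*
  The decreasing Moebius map g y = b (1 - y) / (y + b) exchanges the endpoints of the unit interval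
  and turns each of the four factors x, 1 - x, x + a, x + b into a linear function of y divided by
  y + b, so substituting x = g y on the left gives the right-hand side.
*)

theory Submission
  imports Defs
begin

text \<open>Continuity on the closed interval makes \<open>h\<close> bounded, so a constant multiple
  of the Beta integrand dominates. In both integrals of the theorem the only possible singularities
  are the endpoint powers; all other factors go into \<open>h\<close>.\<close>

lemma set_integrable_Beta_times_continuous:
  fixes p q :: real and h :: "real \<Rightarrow> real"
  assumes "p > -1" "q > -1" and h: "continuous_on {0..1} h"
  shows "set_integrable lborel {0<..<1} (\<lambda>x. x powr p * (1 - x) powr q * h x)"
proof -
  have "compact (h ` {0..1})"
    using h by (intro compact_continuous_image) auto
  then obtain C where C: "\<And>x. x \<in> {0..1} \<Longrightarrow> norm (h x) \<le> C"
    using compact_imp_bounded bounded_iff by (metis imageI)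
  have "set_integrable lborel {0..1} (\<lambda>x. x powr p * (1 - x) powr q)"
    using integrable_Beta[of "p + 1" "q + 1"] assms by simp
  then have "set_integrable lborel {0<..<1} (\<lambda>x. x powr p * (1 - x) powr q)"
    by (rule set_integrable_subset) auto
  then have "set_integrable lborel {0<..<1} (\<lambda>x. x powr p * (1 - x) powr q * C)"
    by (rule set_integrable_mult_left)
  then show ?thesis
  proof (rule set_integrable_bound)
    have "continuous_on {0<..<1} h"
      using h by (rule continuous_on_subset) auto
    then have "continuous_on {0<..<1} (\<lambda>x. x powr p * (1 - x) powr q * h x)"
      by (intro continuous_intros) auto
    then show "set_borel_measurable lborel {0<..<1} (\<lambda>x. x powr p * (1 - x) powr q * h x)"
      unfolding set_borel_measurable_def
      by (simp add: borel_measurable_continuous_on_indicator del: real_scaleR_def)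
    have "norm (x powr p * (1 - x) powr q * h x) \<le> norm (x powr p * (1 - x) powr q * C)"
      if "x \<in> {0<..<1}" for x
    proof -
      have "\<bar>h x\<bar> \<le> \<bar>C\<bar>"
        using C[of x] that by auto
      then show ?thesis
        by (auto simp: abs_mult intro!: mult_left_mono)
    qed
    then show "AE x in lborel. x \<in> {0<..<1} \<longrightarrow>
        norm (x powr p * (1 - x) powr q * h x) \<le> norm (x powr p * (1 - x) powr q * C)"
      by simp
  qed
qed

theorem theorem1p1:
  fixes a b k n s l :: real
  assumes "a > 0" and "b > 0" and "s > -1" and "l > -1"
  shows "set_integrable lborel {0<..<1}
           (\<lambda>x::real. (x powr l * (1 - x) powr s) / ((x + a) powr (k + 1) * (x + b) powr (n + 1)))
    \<and> set_integrable lborel {0<..<1}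
           (\<lambda>x::real. (x powr s * (1 - x) powr l * (x + b) powr (n + k - l - s))
                 / ((a - b) * x + (a + 1) * b) powr (k + 1))
    \<and> (LBINT x:{0<..<1}. (x powr l * (1 - x) powr s) / ((x + a) powr (k + 1) * (x + b) powr (n + 1)))
         = (b + 1) powr (s - n) / b powr (n - l)
           * (LBINT x:{0<..<1}. (x powr s * (1 - x) powr l * (x + b) powr (n + k - l - s))
                 / ((a - b) * x + (a + 1) * b) powr (k + 1))"
proof -
  define F where "F = (\<lambda>x::real. (x powr l * (1 - x) powr s) / ((x + a) powr (k + 1) * (x + b) powr (n + 1)))"
  define G where "G = (\<lambda>x::real. (x powr s * (1 - x) powr l * (x + b) powr (n + k - l - s))
                 / ((a - b) * x + (a + 1) * b) powr (k + 1))"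
  define K where "K = (b + 1) powr (s - n) / b powr (n - l)"
  define g where "g = (\<lambda>y. b * (1 - y) / (y + b))"
  define g' where "g' = (\<lambda>y. - (b * (b + 1)) / (y + b)^2)"
  \<comment> \<open>This expression is the numerator of \<open>g y + a\<close> over
    \<open>y + b\<close>. The endpoints are included because \<open>G_int\<close> needs continuity
    on the closed interval.\<close>
  have D_pos: "(a - b) * y + (a + 1) * b > 0" if "0 \<le> y" "y \<le> 1" for y
  proof -
    have "(a - b) * y + (a + 1) * b = a * (y + b) + b * (1 - y)"
      by (simp add: algebra_simps)
    also have "\<dots> > 0"
      using assms that by (intro add_pos_nonneg) auto
    finally show ?thesis .
  qed
  have F_int: "set_integrable lborel {0<..<1} F"
  proof -
    have "continuous_on {0..1} (\<lambda>x. 1 / ((x + a) powr (k + 1) * (x + b) powr (n + 1)))"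
      using assms by (intro continuous_intros) auto
    from set_integrable_Beta_times_continuous[OF assms(4,3) this] show ?thesis
      by (simp add: F_def)
  qed
  have G_int: "set_integrable lborel {0<..<1} G"
  proof -
    have "continuous_on {0..1} (\<lambda>x. (x + b) powr (n + k - l - s) / ((a - b) * x + (a + 1) * b) powr (k + 1))"
      using assms D_pos by (intro continuous_intros) (auto simp: less_imp_neq[OF D_pos, symmetric])
    from set_integrable_Beta_times_continuous[OF assms(3,4) this] show ?thesis
      by (simp add: G_def)
  qed
  have g_deriv: "(g has_field_derivative g' y) (at y within {0<..<1})" if "y \<in> {0<..<1}" for y
    unfolding g_def g'_def using assms that
    by (auto intro!: derivative_eq_intros simp: power2_eq_square algebra_simps)
  \<comment> \<open>That \<open>g\<close> is an involution of the open interval yields both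
    injectivity and surjectivity.\<close>
  have g_invol: "g (g y) = y \<and> g y \<in> {0<..<1}" if "y \<in> {0<..<1}" for y
  proof -
    have pos: "y + b > 0"
      using assms that by auto
    have "1 - g y = (b + 1) * y / (y + b)" "g y + b = b * (b + 1) / (y + b)"
      using pos by (auto simp: g_def field_simps)
    moreover have "g y > 0" "(b + 1) * y / (y + b) > 0"
      using pos assms that by (auto simp: g_def)
    moreover have "g (g y) = b * (1 - g y) / (g y + b)"
      by (simp add: g_def)
    ultimately show ?thesis
      using pos assms by auto
  qed
  have g_inj: "inj_on g {0<..<1}"
    by (rule inj_on_inverseI[of _ g]) (use g_invol in blast)
  have g_img: "g ` {0<..<1} = {0<..<1}"
    using g_invol by (force simp: image_iff)
  \<comment> \<open>Collecting exponents explains the right-hand side: \<open>b\<close> gets 1 + l -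
    (n + 1) = l - n, \<open>b + 1\<close> gets 1 + s - (n + 1) = s - n, and \<open>y + b\<close>
    gets -2 - l - s + (k + 1) + (n + 1) = n + k - l - s.\<close>
  have subst: "\<bar>g' y\<bar> * F (g y) = K * G y" if "y \<in> {0<..<1}" for y
  proof -
    define t where "t = y + b"
    define d where "d = (a - b) * y + (a + 1) * b"
    have pos: "0 < t" "0 < d" "0 < y" "0 < 1 - y" "0 < b + 1"
      using assms that D_pos[of y] by (auto simp: t_def d_def)
    have lin: "g y = b * (1 - y) / t" "1 - g y = (b + 1) * y / t"
      "g y + a = d / t" "g y + b = b * (b + 1) / t"
      using pos assms by (auto simp: g_def d_def t_def field_simps)
    have g'_abs: "\<bar>g' y\<bar> = b * (b + 1) / t^2"
      using pos assms by (simp add: g'_def t_def abs_mult)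
    have Fg: "\<bar>g' y\<bar> * F (g y) = b * (b + 1) / t^2 *
        ((b * (1 - y) / t) powr l * ((b + 1) * y / t) powr s /
          ((d / t) powr (k + 1) * (b * (b + 1) / t) powr (n + 1)))"
      \<comment> \<open>\<open>lin(1)\<close> has to come last: it would rewrite the
        \<open>g y\<close> inside \<open>1 - g y\<close>, \<open>g y + a\<close> and
        \<open>g y + b\<close>.\<close>
      unfolding F_def g'_abs lin(2-4) by (simp add: lin(1))
    have KG: "K * G y = (b + 1) powr (s - n) / b powr (n - l) *
        (y powr s * (1 - y) powr l * t powr (n + k - l - s) / d powr (k + 1))"
      by (simp add: K_def G_def t_def d_def)
    \<comment> \<open>Both sides are positive, so logarithms may be compared; these are linear in
      the logarithms of \<open>b\<close>, \<open>b + 1\<close>, \<open>y\<close>,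
      \<open>1 - y\<close>, \<open>t\<close> and \<open>d\<close>.\<close>
    have "ln (\<bar>g' y\<bar> * F (g y)) = ln (K * G y)"
      unfolding Fg KG using pos \<open>b > 0\<close>
      by (simp add: ln_mult ln_div ln_powr ln_realpow) (simp add: algebra_simps)
    moreover have "\<bar>g' y\<bar> * F (g y) > 0" "K * G y > 0"
      unfolding Fg KG using pos \<open>b > 0\<close> by auto
    ultimately show ?thesis
      by simp
  qed
  \<comment> \<open>The change of variables is done with the gauge integral \<open>integral\<close>.
    The absolute value of \<open>g'\<close> absorbs the reversal of orientation by the decreasing
    map \<open>g\<close>.\<close>
  have "integral {0<..<1} F = integral {0<..<1} (\<lambda>y. \<bar>g' y\<bar> *\<^sub>R F (g y))"
  proof -
    \<comment> \<open>Absolute integrability refers to \<open>lebesgue\<close>, the completion of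
      \<open>lborel\<close>, to which integrability transfers.\<close>
    have "F absolutely_integrable_on g ` {0<..<1}"
      unfolding g_img using F_int
      by (simp add: set_integrable_def integrable_completion borel_measurable_integrable)
    then show ?thesis
      using has_absolute_integral_change_of_variables_1'[OF _ g_deriv g_inj, of F] g_img by auto
  qed
  also have "\<dots> = integral {0<..<1} (\<lambda>y. K * G y)"
    by (intro integral_cong) (simp add: subst)
  also have "\<dots> = K * integral {0<..<1} G"
    by simp
  \<comment> \<open>Integrability of \<open>F\<close> and \<open>G\<close> identifies their gauge
    integrals with the Lebesgue integrals of the claim.\<close>
  finally have "(LINT x:{0<..<1}|lborel. F x) = K * (LINT x:{0<..<1}|lborel. G x)"
    by (simp add: set_borel_integral_eq_integral F_int G_int)
  with F_int G_int show ?thesis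
    unfolding F_def G_def K_def by blast
qed

end
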